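(* For every integer $n \ge 1$, $$f_n\!\left(\frac{\prod_{1\le i\le n} p_i}{p_n-1}\right) = f_{n-1}\!\left(\prod_{1\le i\le n-1} p_i\right).$$
   Context: $p_i$ denotes the $i$-th prime number ($p_1=2$, $p_2=3$, $p_3=5,\dots$). An integer is called an $n$-prime if it is not divisible by any of the first $n$ primes $p_1,\dots,p_n$ (so every integer is a $0$-prime). For a real number $x\ge 0$, $f_n(x)$ denotes the number of positive $n$-primes $\le x$. An empty product equals $1$. *)

theory Defs
  imports Complex_Main "HOL-Library.Infinite_Set" "HOL-Computational_Algebra.Primes"
begin

text \<open>The primes are numbered from 1, while \<^const>\<open>enumerate\<close> counts from 0.
  The value at \<open>i = 0\<close> is junk and is never used below.\<close>

definition nth_prime :: "nat \<Rightarrow> nat" where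
  "nth_prime i = enumerate {q. prime q} (i - 1)"

definition n_prime :: "nat \<Rightarrow> int \<Rightarrow> bool" where
  "n_prime n m \<longleftrightarrow> (\<forall>i\<in>{1..n}. \<not> int (nth_prime i) dvd m)"

definition n_prime_count :: "nat \<Rightarrow> real \<Rightarrow> nat" where
  "n_prime_count n x = card {m::int. 0 < m \<and> real_of_int m \<le> x \<and> n_prime n m}"

end

theory Submission
  imports Defs
begin

text \<open>
  Write \<open>P\<close> for the product of the first \<open>n - 1\<close> primes and \<open>p\<close> for the \<open>n\<close>-th prime, and put
  \<open>y = P / (p - 1)\<close>. The argument on the left is \<open>x = P * p / (p - 1)\<close>, and it satisfies both
  \<open>x = P + y\<close> and \<open>x / p = y\<close>. Removing the multiples of \<open>p\<close> from the \<open>(n - 1)\<close>-primes gives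
  \<open>f\<^bsub>n-1\<^esub>(x) = f\<^bsub>n\<^esub>(x) + f\<^bsub>n-1\<^esub>(y)\<close>, while \<open>P\<close>-periodicity gives
  \<open>f\<^bsub>n-1\<^esub>(x) = f\<^bsub>n-1\<^esub>(P) + f\<^bsub>n-1\<^esub>(y)\<close>.
\<close>

lemma prime_nth_prime: "prime (nth_prime i)"
  using enumerate_in_set[OF primes_infinite] by (simp add: nth_prime_def)

text \<open>Both indices must be positive: truncated subtraction gives
  \<open>nth_prime 0 = nth_prime 1\<close>.\<close>

lemma nth_prime_eq_iff:
  assumes "i \<ge> 1" "j \<ge> 1"
  shows "nth_prime i = nth_prime j \<longleftrightarrow> i = j"
proof -
  have "inj (enumerate {q::nat. prime q})"
    using strict_mono_enumerate[OF primes_infinite] by (rule strict_mono_imp_inj_on)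
  then have "nth_prime i = nth_prime j \<longleftrightarrow> i - 1 = j - 1"
    unfolding nth_prime_def by (rule inj_eq)
  then show ?thesis using assms by auto
qed

lemma n_prime_Suc:
  "n_prime (Suc n) m \<longleftrightarrow> n_prime n m \<and> \<not> int (nth_prime (Suc n)) dvd m"
  by (auto simp: n_prime_def atLeastAtMostSuc_conv)

text \<open>Each of the first \<open>n\<close> primes divides their product, so the shift preserves
  divisibility by each of them.\<close>

lemma n_prime_add_primorial:
  "n_prime n (int (\<Prod>i=1..n. nth_prime i) + m) \<longleftrightarrow> n_prime n m"
proof -
  have "int (nth_prime i) dvd int (\<Prod>i=1..n. nth_prime i)" if "i \<in> {1..n}" for i
    using that by (simp only: int_dvd_int_iff) (rule dvd_prodI, auto)
  then show ?thesis
    unfolding n_prime_def by (simp add: dvd_add_right_iff del: of_nat_prod)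
qed

text \<open>By Euclid's lemma: an earlier prime dividing the product must divide \<open>m\<close>,
  being distinct from the new prime.\<close>

lemma n_prime_mult_next_prime:
  "n_prime n (int (nth_prime (Suc n)) * m) \<longleftrightarrow> n_prime n m"
proof -
  have "\<not> int (nth_prime i) dvd int (nth_prime (Suc n))" if "i \<in> {1..n}" for i
    using that nth_prime_eq_iff[of i "Suc n"] primes_dvd_imp_eq[OF prime_nth_prime prime_nth_prime]
    by fastforce
  then show ?thesis
    unfolding n_prime_def by (auto simp: prime_dvd_mult_iff prime_nth_prime)
qed

lemma finite_pos_int_le_real: "finite {m::int. 0 < m \<and> real_of_int m \<le> x \<and> Q m}"
  by (rule finite_subset[of _ "{0..\<lfloor>x\<rfloor>}"]) (auto simp: le_floor_iff)

text \<open>Cut the range at the primorial \<open>P\<close>; what lies above it is the translate by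
  \<open>P\<close> of the \<open>n\<close>-primes up to \<open>y\<close>.\<close>

lemma n_prime_count_add_primorial:
  assumes "y \<ge> 0"
  shows "n_prime_count n (real (\<Prod>i=1..n. nth_prime i) + y) =
    n_prime_count n (real (\<Prod>i=1..n. nth_prime i)) + n_prime_count n y"
proof -
  define P where "P = (\<Prod>i=1..n. nth_prime i)"
  define S where "S x = {m::int. 0 < m \<and> real_of_int m \<le> x \<and> n_prime n m}" for x
  have shift: "n_prime n (int P + m) \<longleftrightarrow> n_prime n m" for m
    unfolding P_def by (rule n_prime_add_primorial)
  have "S (real P + y) = S (real P) \<union> (\<lambda>m. int P + m) ` S y"
  proof (intro equalityI subsetI)
    fix m assume m: "m \<in> S (real P + y)"
    show "m \<in> S (real P) \<union> (\<lambda>m. int P + m) ` S y"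
    proof (cases "m \<le> int P")
      case True
      with m show ?thesis by (auto simp: S_def)
    next
      case False
      then have "m - int P \<in> S y" using m shift[of "m - int P"] by (auto simp: S_def)
      then show ?thesis by (intro UnI2 image_eqI[of _ _ "m - int P"]) auto
    qed
  \<comment> \<open>Reverse inclusion: \<open>y \<ge> 0\<close> keeps \<open>S (real P)\<close>
    inside \<open>S (real P + y)\<close>.\<close>
  qed (use assms shift in \<open>auto simp: S_def\<close>)
  moreover have "S (real P) \<inter> (\<lambda>m. int P + m) ` S y = {}"
    by (auto simp: S_def)
  ultimately have "card (S (real P + y)) = card (S (real P)) + card (S y)"
    using finite_pos_int_le_real[of _ "n_prime n"]
    by (simp add: card_Un_disjoint card_image S_def)
  then show ?thesis by (simp only: P_def S_def n_prime_count_def)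
qed

text \<open>The \<open>n\<close>-primes up to \<open>x\<close> that are not
  \<open>Suc n\<close>-primes are the multiples of the next prime \<open>p\<close>; division by
  \<open>p\<close> maps them bijectively onto the \<open>n\<close>-primes up to
  \<open>x / p\<close>.\<close>

lemma n_prime_count_sieve:
  "n_prime_count n x = n_prime_count (Suc n) x + n_prime_count n (x / real (nth_prime (Suc n)))"
proof -
  define p where "p = nth_prime (Suc n)"
  define S where "S k x = {m::int. 0 < m \<and> real_of_int m \<le> x \<and> n_prime k m}" for k x
  have fin: "finite (S k x)" for k x
    unfolding S_def by (rule finite_pos_int_le_real)
  have p0: "p > 0" using prime_nth_prime prime_gt_0_nat by (auto simp: p_def)
  have le: "real p * real_of_int m \<le> x \<longleftrightarrow> real_of_int m \<le> x / real p" for m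
    using p0 by (simp add: pos_le_divide_eq mult.commute)
  have "m \<in> S n x \<longleftrightarrow> m \<in> S (Suc n) x \<union> (\<lambda>m. int p * m) ` S n (x / real p)" for m
  proof (cases "int p dvd m")
    case True
    then obtain k where "m = int p * k" by blast
    then show ?thesis
      using p0 le[of k] n_prime_mult_next_prime[of n k]
      by (auto simp: S_def n_prime_Suc p_def[symmetric] zero_less_mult_iff)
  qed (auto simp: S_def n_prime_Suc p_def)
  then have "S n x = S (Suc n) x \<union> (\<lambda>m. int p * m) ` S n (x / real p)" by blast
  moreover have "S (Suc n) x \<inter> (\<lambda>m. int p * m) ` S n (x / real p) = {}"
    by (auto simp: S_def n_prime_Suc p_def)
  moreover have "inj_on (\<lambda>m. int p * m) (S n (x / real p))"
    using p0 by (auto simp: inj_on_def)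
  ultimately have "card (S n x) = card (S (Suc n) x) + card (S n (x / real p))"
    by (simp add: fin card_Un_disjoint card_image)
  then show ?thesis by (simp only: p_def S_def n_prime_count_def)
qed

theorem theorem6:
  fixes n :: nat
  assumes "n \<ge> 1"
  shows "n_prime_count n ((\<Prod>i=1..n. real (nth_prime i)) / (real (nth_prime n) - 1))
       = n_prime_count (n - 1) (\<Prod>i=1..n - 1. real (nth_prime i))"
proof -
  obtain k where n: "n = Suc k" using assms by (cases n) auto
  define p where "p = real (nth_prime n)"
  define P where "P = real (\<Prod>i=1..k. nth_prime i)"
  define y where "y = P / (p - 1)"
  have p: "p > 1" using prime_gt_1_nat[OF prime_nth_prime[of n]] by (simp add: p_def)
  have y0: "y \<ge> 0" using p by (simp add: y_def P_def prod_nonneg)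
  have prod: "(\<Prod>i=1..n. real (nth_prime i)) = P * p"
    by (simp add: n P_def p_def atLeastAtMostSuc_conv mult.commute)
  \<comment> \<open>Both identities restate \<open>y * (p - 1) = P\<close>, that is,
    \<open>P + y = p * y\<close>.\<close>
  have x: "P * p / (p - 1) = P + y" and xp: "(P + y) / p = y"
    using p by (simp_all add: y_def field_simps)
  have "n_prime_count k (P + y) = n_prime_count n (P + y) + n_prime_count k y"
    using n_prime_count_sieve[of k "P + y"] xp by (simp add: n p_def)
  moreover have "n_prime_count k (P + y) = n_prime_count k P + n_prime_count k y"
    using n_prime_count_add_primorial[OF y0] by (simp add: P_def)
  \<comment> \<open>The common term \<open>n_prime_count k y\<close> cancels.\<close>
  ultimately have "n_prime_count n (P * p / (p - 1)) = n_prime_count k P"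
    by (simp add: x)
  then show ?thesis
    unfolding prod p_def[symmetric] by (simp add: n P_def)
qed

end
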